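(* The odd $*$-Fibonacci polynomials satisfy, for every integer $n$, $$g_{n+1}F_{2n+3}^2-g_nF_{2n+5}F_{2n+1}=s_3\bigl(g_nF_{2n+1}^2-g_{n-1}F_{2n+3}F_{2n-1}\bigr)=s_3^{n}\bigl(s_1^3s_3+s_2^3-s_1^2s_2^2\bigr).$$
   Context: For an integer $n$ put $g_n=s_2$ if $n$ is odd and $g_n=s_1$ if $n$ is even. The odd $*$-Fibonacci polynomials are defined by $F_1=s_1$, $F_3=s_1^2-s_2$, and $F_{2n+3}=g_nF_{2n+1}-s_3F_{2n-1}$. The recurrence is also run backwards to define Laurent polynomials $F_{2n+1}\in\mathbb Z[s_1,s_2,s_3^{\pm1}]$ for all integers $n$; for example $F_{-1}=s_2/s_3$. *)

theory Defs
  imports "HOL-Library.Poly_Mapping" "HOL-Library.Product_Plus"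
begin

text \<open>
  The Laurent polynomial ring $Z[s_1, s_2, s_3^{\pm 1}]$ is the monoid ring over the integers
  of the exponent monoid $N \times N \times Z$; the product of \<^typ>\<open>'a \<Rightarrow>\<^sub>0 'b\<close> is convolution.
\<close>

type_synonym laurent = "(nat \<times> nat \<times> int) \<Rightarrow>\<^sub>0 int"

definition s1 :: laurent where "s1 = Poly_Mapping.single (1, 0, 0) 1"
definition s2 :: laurent where "s2 = Poly_Mapping.single (0, 1, 0) 1"
definition s3 :: laurent where "s3 = Poly_Mapping.single (0, 0, 1) 1"
definition s3_inv :: laurent where "s3_inv = Poly_Mapping.single (0, 0, -1) 1"

lemma s3_mult_s3_inv: "s3 * s3_inv = 1"
  by (simp add: s3_def s3_inv_def mult_single flip: single_one zero_prod_def)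

text \<open>
  Integer powers of the unit \<^const>\<open>s3\<close>; the library's \<open>powi\<close> is not available here because
  \<^typ>\<open>laurent\<close> has no \<open>inverse\<close> operation.
\<close>

definition s3_powi :: "int \<Rightarrow> laurent" where
  "s3_powi n = (if n \<ge> 0 then s3 ^ nat n else s3_inv ^ nat (- n))"

definition g :: "int \<Rightarrow> laurent" where
  "g n = (if odd n then s2 else s1)"

text \<open>
  \<open>F m\<close> is meaningful for odd \<open>m\<close> only (the value at even \<open>m\<close> is a dummy).  The last two
  branches are the recurrence $F_{2n+3} = g_n F_{2n+1} - s_3 F_{2n-1}$ with $m = 2n+3$, and the
  same recurrence solved for $F_{2n-1}$ with $m = 2n-1$; see \<open>F_rec\<close> below.
\<close>

function F :: "int \<Rightarrow> laurent" where
  "F m =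
    (if even m then 0
     else if m = 1 then s1
     else if m = 3 then s1\<^sup>2 - s2
     else if m > 3 then g ((m - 3) div 2) * F (m - 2) - s3 * F (m - 4)
     else s3_inv * (g ((m + 1) div 2) * F (m + 2) - F (m + 4)))"
  by auto
termination
proof (relation "measure (\<lambda>m. nat \<bar>m - 2\<bar>)", goal_cases)
  case (3 m)
  then have "m \<ge> 5" by presburger
  then show ?case by simp
next
  case (4 m)
  then have "m \<le> -1" by presburger
  then show ?case by simp
next
  case (5 m)
  then have "m \<le> -1" by presburger
  then show ?case by simp
qed auto

declare F.simps [simp del]

lemma F_1: "F 1 = s1"
  by (simp add: F.simps)

lemma F_3: "F 3 = s1\<^sup>2 - s2"
  by (simp add: F.simps)

lemma F_minus_1: "F (-1) = s2 * s3_inv"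
  by (subst F.simps) (simp add: F_1 F_3 g_def power2_eq_square mult.commute)

lemma F_rec: "F (2 * n + 3) = g n * F (2 * n + 1) - s3 * F (2 * n - 1)"
proof (cases "n \<ge> 1")
  case True
  then show ?thesis by (subst F.simps) (simp add: algebra_simps)
next
  case False
  have "s3 * F (2 * n - 1) = (s3 * s3_inv) * (g n * F (2 * n + 1) - F (2 * n + 3))"
    using False by (subst F.simps) (simp add: algebra_simps)
  then show ?thesis by (simp add: s3_mult_s3_inv)
qed

end

theory Submission
  imports Defs
begin

text \<open>
  With $D_n = g_n F_{2n+1}^2 - g_{n-1} F_{2n+3} F_{2n-1}$ the claim is a Cassini identity: the
  sequence $D_n$ is geometric with ratio $s_3$.  The coefficients of the recurrence alternate
  between $s_1$ and $s_2$, and the weights $g_n$, $g_{n-1}$ in $D_n$ are placed so that, thanks to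
  $g_{n+1} = g_{n-1}$, one application of the recurrence to $F_{2n+5}$ and one to $F_{2n+3}$ turn
  $D_{n+1}$ into $s_3 D_n$ (lemma \<open>cassini_step\<close>).  The constant is read off at $n = 0$, where
  $F_{-1} = s_2 s_3^{-1}$.  Since $s_3$ is a unit, the ratio can be undone, so the closed form
  holds for negative $n$ too (lemma \<open>cassini_closed_form\<close>).
\<close>

definition cassini :: "int \<Rightarrow> laurent" where
  "cassini n = g n * (F (2 * n + 1))\<^sup>2 - g (n - 1) * F (2 * n + 3) * F (2 * n - 1)"

lemma s3_left_cancel:
  assumes "s3 * x = s3 * y"
  shows "x = y"
proof -
  have "(s3 * s3_inv) * x = (s3 * s3_inv) * y"
    using assms by (metis mult.assoc mult.commute)
  then show ?thesis
    by (simp add: s3_mult_s3_inv)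
qed

lemma s3_powi_add_one: "s3_powi (n + 1) = s3 * s3_powi n"
proof (cases "n \<ge> 0")
  case True
  then show ?thesis
    by (simp add: s3_powi_def nat_add_distrib)
next
  case False
  then have "nat (- n) = Suc (nat (- (n + 1)))"
    by simp
  then have "s3 * s3_powi n = (s3 * s3_inv) * s3_inv ^ nat (- (n + 1))"
    using False by (simp add: s3_powi_def mult.assoc)
  also have "\<dots> = s3_powi (n + 1)"
    using False by (simp add: s3_mult_s3_inv s3_powi_def)
  finally show ?thesis ..
qed

text \<open>
  Write $a, b, c$ for $F_{2n-1}, F_{2n+1}, F_{2n+3}$.  Expanding only $F_{2n+5} = g_{n+1} c - s_3 b$
  gives $D_{n+1} = g_{n+1} c (c - g_n b) + s_3 g_n b^2$, and the bracket is $-s_3 a$.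
\<close>

lemma cassini_step: "cassini (n + 1) = s3 * cassini n"
proof -
  define a b c where "a = F (2 * n - 1)" and "b = F (2 * n + 1)" and "c = F (2 * n + 3)"
  have c: "c = g n * b - s3 * a"
    unfolding a_def b_def c_def by (rule F_rec)
  have d: "F (2 * n + 5) = g (n + 1) * c - s3 * b"
    using F_rec[of "n + 1"] by (simp add: b_def c_def algebra_simps)
  have period: "g (n + 1) = g (n - 1)"
    by (simp add: g_def)
  have "cassini (n + 1) = g (n + 1) * c\<^sup>2 - g n * F (2 * n + 5) * b"
    by (simp add: cassini_def b_def c_def algebra_simps)
  also have "\<dots> = g (n - 1) * c * (c - g n * b) + s3 * g n * b\<^sup>2"
    unfolding d period by (simp add: algebra_simps power2_eq_square)
  also have "c - g n * b = - (s3 * a)"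
    by (simp add: c)
  finally show ?thesis
    by (simp add: cassini_def a_def b_def c_def algebra_simps)
qed

lemma cassini_zero: "s3 * cassini 0 = s1 ^ 3 * s3 + s2 ^ 3 - s1\<^sup>2 * s2\<^sup>2"
proof -
  have "s3 * cassini 0 = s1 ^ 3 * s3 - (s3 * s3_inv) * (s2\<^sup>2 * (s1\<^sup>2 - s2))"
    by (simp add: cassini_def g_def F_1 F_3 F_minus_1 algebra_simps power2_eq_square power3_eq_cube)
  then show ?thesis
    by (simp add: s3_mult_s3_inv algebra_simps power2_eq_square power3_eq_cube)
qed

lemma cassini_closed_form:
  "s3 * cassini n = s3_powi n * (s1 ^ 3 * s3 + s2 ^ 3 - s1\<^sup>2 * s2\<^sup>2)"
proof (induction n rule: int_induct[where k = 0])
  case base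
  show ?case
    by (simp add: cassini_zero s3_powi_def)
next
  case (step1 n)
  then show ?case
    by (simp add: cassini_step s3_powi_add_one mult.assoc)
next
  case (step2 n)
  show ?case
  proof (rule s3_left_cancel)
    show "s3 * (s3 * cassini (n - 1))
        = s3 * (s3_powi (n - 1) * (s1 ^ 3 * s3 + s2 ^ 3 - s1\<^sup>2 * s2\<^sup>2))"
      using step2 cassini_step[of "n - 1"] s3_powi_add_one[of "n - 1"]
      by (simp add: mult.assoc)
  qed
qed

theorem theorem8p15:
  fixes n :: int
  shows "g (n + 1) * (F (2 * n + 3))\<^sup>2 - g n * F (2 * n + 5) * F (2 * n + 1)
           = s3 * (g n * (F (2 * n + 1))\<^sup>2 - g (n - 1) * F (2 * n + 3) * F (2 * n - 1))
       \<and> s3 * (g n * (F (2 * n + 1))\<^sup>2 - g (n - 1) * F (2 * n + 3) * F (2 * n - 1))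
           = s3_powi n * (s1 ^ 3 * s3 + s2 ^ 3 - s1\<^sup>2 * s2\<^sup>2)"
proof
  show "g (n + 1) * (F (2 * n + 3))\<^sup>2 - g n * F (2 * n + 5) * F (2 * n + 1)
      = s3 * (g n * (F (2 * n + 1))\<^sup>2 - g (n - 1) * F (2 * n + 3) * F (2 * n - 1))"
    using cassini_step[of n] by (simp add: cassini_def algebra_simps)
  show "s3 * (g n * (F (2 * n + 1))\<^sup>2 - g (n - 1) * F (2 * n + 3) * F (2 * n - 1))
      = s3_powi n * (s1 ^ 3 * s3 + s2 ^ 3 - s1\<^sup>2 * s2\<^sup>2)"
    using cassini_closed_form[of n] by (simp only: cassini_def)
qed

end
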